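(* Let $p>3$ be a prime, let $q$ be a power of $p$, and let $\varepsilon=\left(\frac{q}{3}\right)$ be the Legendre symbol, so that $\varepsilon=\pm1$ according to whether $q\equiv\pm1\pmod 3$. Then $$\sum_{0\le k<q/3}\binom{3k}{k}3^{-k}\equiv\varepsilon\,F_{2(2q+\varepsilon)/3}\pmod{p}$$ and $$\sum_{q/2<k<2q/3}\binom{3k}{k}3^{-k}\equiv\varepsilon\,F_{2(q-\varepsilon)/3}\pmod{p}.$$
   Context: $F_n$ denotes the $n$-th Fibonacci number, with $F_0=0$, $F_1=1$, $F_{n+2}=F_{n+1}+F_n$. Here $q=p^f$ with $f\ge 1$, the sums are over integers $k$ in the indicated ranges, and the congruences are in the ring $\mathbb{Z}_{(p)}$ of rationals with denominator prime to $p$ (where $3$ is invertible). *)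

theory Defs
  imports "HOL-Number_Theory.Number_Theory"
begin

text \<open>The ring \<open>\<int>\<^bsub>(p)\<^esub>\<close> of rationals with denominator prime to \<open>p\<close>.\<close>

definition localized_ints :: "nat \<Rightarrow> rat set" where
  "localized_ints p = {of_int a / of_int b | a b :: int. b \<noteq> 0 \<and> coprime b (int p)}"

text \<open>
  Congruence modulo the ideal generated by \<open>p\<close> in \<open>\<int>\<^bsub>(p)\<^esub>\<close>. Membership of both sides is part
  of the definition.
\<close>

definition cong_localized :: "rat \<Rightarrow> rat \<Rightarrow> nat \<Rightarrow> bool" where
  "cong_localized x y p \<longleftrightarrow>
     x \<in> localized_ints p \<and> y \<in> localized_ints p \<and>
     (\<exists>z \<in> localized_ints p. x - y = of_nat p * z)"

end

theory Submission
  imports Defs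
begin

text \<open>
  Let \<open>t \<in> {1, 2}\<close> and \<open>N = \<lfloor>t q / 3\<rfloor>\<close>, so that \<open>3 N + b = t q\<close> with \<open>{a, b} = {1, 2}\<close>. Then exactly
  \<open>(-27)\<^sup>k \<cdot> C(N + k, 2k) = C(3k, k) \<cdot> \<Prod>\<^bsub>i<k\<^esub> (1 + t q / (3i + a)) (1 - t q / (3i + b))\<close>.
  A factor \<open>1 \<plusminus> t q / d\<close> is \<open>1\<close> modulo \<open>p\<close> unless \<open>q\<close> divides \<open>d\<close>; this happens only for
  \<open>t = 2\<close> and \<open>3i + a = q\<close>, where the factor is \<open>3\<close>. On the other side,
  \<open>\<Sum>\<^sub>k C(N + k, 2k) (-9)\<^sup>k = (-1)\<^sup>N F\<^bsub>4N+2\<^esub>\<close>. The case \<open>t = 1\<close> is the first congruence. As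
  \<open>C(3k, k)\<close> vanishes modulo \<open>p\<close> for \<open>q / 3 < k < q / 2\<close>, the case \<open>t = 2\<close> evaluates the first sum
  plus three times the second. The resulting difference of Fibonacci numbers is reduced with
  \<open>F\<^bsub>2c\<^esub> + F\<^bsub>4q+2c\<^esub> \<equiv> 3 F\<^bsub>2q+2c\<^esub>\<close>, obtained by expanding \<open>(1 + \<phi>\<^sup>4)\<^sup>q = (3 \<phi>\<^sup>2)\<^sup>q\<close>.
\<close>

section \<open>Binomial sums at -9 and recurrences for even-indexed Fibonacci numbers\<close>

text \<open>Pascal's rule on the upper index leaves terms with odd lower index, and shifting
  \<open>k\<close> there costs one factor \<open>z\<close>. With the companion below this gives a
  coupled recurrence for the sums over even and odd lower indices.\<close>

lemma sum_choose_even_index_Suc: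
  fixes z :: int
  shows "(\<Sum>k\<le>Suc n. int ((Suc n + k) choose (2 * k)) * z ^ k) =
         (\<Sum>k\<le>n. int ((n + k) choose (2 * k)) * z ^ k) +
         z * (\<Sum>k\<le>n. int ((n + k + 1) choose (2 * k + 1)) * z ^ k)"
proof -
  have "(\<Sum>k\<le>Suc n. int ((Suc n + k) choose (2 * k)) * z ^ k) =
        (1 + (\<Sum>k\<le>n. int ((n + k + 1) choose (2 * k + 2)) * z ^ Suc k)) +
        z * (\<Sum>k\<le>n. int ((n + k + 1) choose (2 * k + 1)) * z ^ k)"
    by (subst sum.atMost_Suc_shift) (simp add: algebra_simps sum.distrib sum_distrib_left)
  also have "1 + (\<Sum>k\<le>n. int ((n + k + 1) choose (2 * k + 2)) * z ^ Suc k) =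
             (\<Sum>k\<le>Suc n. int ((n + k) choose (2 * k)) * z ^ k)"
    by (subst sum.atMost_Suc_shift) simp
  finally show ?thesis
    by (simp add: binomial_eq_0)
qed

lemma sum_choose_odd_index_Suc:
  fixes z :: int
  shows "(\<Sum>k\<le>Suc n. int ((Suc n + k + 1) choose (2 * k + 1)) * z ^ k) =
         (\<Sum>k\<le>n. int ((n + k + 1) choose (2 * k + 1)) * z ^ k) +
         (\<Sum>k\<le>Suc n. int ((Suc n + k) choose (2 * k)) * z ^ k)"
proof -
  have "(\<Sum>k\<le>Suc n. int ((Suc n + k + 1) choose (2 * k + 1)) * z ^ k) =
        (\<Sum>k\<le>Suc n. int ((n + k + 1) choose (2 * k + 1)) * z ^ k) +
        (\<Sum>k\<le>Suc n. int ((Suc n + k) choose (2 * k)) * z ^ k)"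
    unfolding sum.distrib [symmetric]
    by (intro sum.cong refl) (simp add: algebra_simps)
  then show ?thesis
    by (simp add: binomial_eq_0)
qed

lemma fib_add_4: "fib (n + 4) + fib n = 3 * fib (n + 2)"
  by (simp add: numeral_eq_Suc)

text \<open>The two sums determine each other's next value, so they are evaluated in one induction.
  Since \<open>-9 = -3 * 3\<close>, scaling the odd-index sum by 3 turns both steps, up to sign,
  into \<open>F(n+4) = 3 F(n+2) - F(n)\<close>.\<close>

lemma sum_choose_neg_9_pow:
  "(\<Sum>k\<le>n. int ((n + k) choose (2 * k)) * (-9) ^ k) = (-1) ^ n * int (fib (4 * n + 2))"
  "3 * (\<Sum>k\<le>n. int ((n + k + 1) choose (2 * k + 1)) * (-9) ^ k) =
     (-1) ^ n * int (fib (4 * n + 4))"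
proof (induction n)
  case 0
  show "(\<Sum>k\<le>0. int ((0 + k) choose (2 * k)) * (-9) ^ k) = (-1) ^ 0 * int (fib (4 * 0 + 2))"
    by simp
  show "3 * (\<Sum>k\<le>0. int ((0 + k + 1) choose (2 * k + 1)) * (-9) ^ k) =
     (-1) ^ 0 * int (fib (4 * 0 + 4))"
    by (simp add: numeral_eq_Suc)
next
  case (Suc n)
  have f6: "int (fib (4 * n + 6)) = 3 * int (fib (4 * n + 4)) - int (fib (4 * n + 2))"
    using arg_cong [OF fib_add_4 [of "4 * n + 2"], of int]
    by (simp add: add.assoc del: fib.simps add_2_eq_Suc add_2_eq_Suc')
  have f8: "int (fib (4 * n + 8)) = 3 * int (fib (4 * n + 6)) - int (fib (4 * n + 4))"
    using arg_cong [OF fib_add_4 [of "4 * n + 4"], of int]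
    by (simp add: add.assoc del: fib.simps add_2_eq_Suc add_2_eq_Suc')
  have idx: "4 * Suc n + 2 = 4 * n + 6" "4 * Suc n + 4 = 4 * n + 8"
    by simp_all
  have "(\<Sum>k\<le>Suc n. int ((Suc n + k) choose (2 * k)) * (-9) ^ k) =
        (-1) ^ n * int (fib (4 * n + 2)) - 3 * ((-1) ^ n * int (fib (4 * n + 4)))"
    unfolding sum_choose_even_index_Suc Suc.IH(1) Suc.IH(2) [symmetric] by simp
  also have "\<dots> = (-1) ^ Suc n * int (fib (4 * Suc n + 2))"
    unfolding idx f6 by (simp add: algebra_simps)
  finally show A: "(\<Sum>k\<le>Suc n. int ((Suc n + k) choose (2 * k)) * (-9) ^ k) =
        (-1) ^ Suc n * int (fib (4 * Suc n + 2))" .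
  have "3 * (\<Sum>k\<le>Suc n. int ((Suc n + k + 1) choose (2 * k + 1)) * (-9) ^ k) =
        (-1) ^ n * int (fib (4 * n + 4)) + 3 * ((-1) ^ Suc n * int (fib (4 * Suc n + 2)))"
    unfolding sum_choose_odd_index_Suc A distrib_left Suc.IH(2) ..
  also have "\<dots> = (-1) ^ Suc n * int (fib (4 * Suc n + 4))"
    unfolding idx f8 by (simp add: algebra_simps)
  finally show "3 * (\<Sum>k\<le>Suc n. int ((Suc n + k + 1) choose (2 * k + 1)) * (-9) ^ k) =
        (-1) ^ Suc n * int (fib (4 * Suc n + 4))" .
qed

text \<open>\<open>F\<^bsub>2m\<^esub>\<close> for integers \<open>m\<close>: extended backwards, the Fibonacci sequence satisfies \<open>F\<^bsub>-2m\<^esub> = -F\<^bsub>2m\<^esub>\<close>.\<close>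

definition even_fib :: "int \<Rightarrow> int" where
  "even_fib m = sgn m * int (fib (nat (2 * \<bar>m\<bar>)))"

lemma even_fib_minus: "even_fib (- m) = - even_fib m"
  by (simp add: even_fib_def)

lemma even_fib_of_nat: "even_fib (int n) = int (fib (2 * n))"
  by (cases "n = 0") (simp_all add: even_fib_def nat_mult_distrib)

lemma even_fib_rec: "even_fib (m + 2) + even_fib m = 3 * even_fib (m + 1)"
proof -
  have nonneg: "even_fib (int n + 2) + even_fib (int n) = 3 * even_fib (int n + 1)" for n
    using fib_add_4 [of "2 * n"] even_fib_of_nat [of "n + 2"] even_fib_of_nat [of "n + 1"]
    by (simp add: even_fib_of_nat add.commute)
  \<comment> \<open>The reflection sending \<open>m\<close> to \<open>-m - 2\<close> swaps the two
    outer terms up to sign, so the case \<open>m <= -2\<close> follows from \<open>m >= 0\<close>;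
    its fixed point \<open>m = -1\<close> is checked directly.\<close>
  consider n where "m = int n" | "m = -1" | n where "m = - int n - 2"
  proof (cases "m \<ge> -1")
    case True
    then show ?thesis
      using that(1) [of "nat m"] that(2) by fastforce
  next
    case False
    then show ?thesis
      using that(3) [of "nat (- m - 2)"] by simp
  qed
  then show ?thesis
  proof cases
    case 1
    then show ?thesis using nonneg by simp
  next
    case 2
    then show ?thesis using even_fib_minus [of 1] by (simp add: even_fib_def)
  next
    case (3 n)
    have "even_fib (m + 2) + even_fib m = - (even_fib (int n) + even_fib (int n + 2))"
      using even_fib_minus [of "int n"] even_fib_minus [of "int n + 2"] 3 by simp
    also have "\<dots> = - 3 * even_fib (int n + 1)"
      using nonneg [of n] by simp
    moreover have "m + 1 = - (int n + 1)"
      using 3 by simp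
    ultimately show ?thesis
      by (simp only: even_fib_minus)
  qed
qed

section \<open>Fibonacci numbers and binomial coefficients modulo \<open>p\<close>\<close>

lemma sum_choose_Suc_mult:
  fixes g :: "nat \<Rightarrow> 'a :: comm_semiring_1"
  shows "(\<Sum>j\<le>Suc n. of_nat (Suc n choose j) * g j) =
         (\<Sum>j\<le>n. of_nat (n choose j) * (g j + g (Suc j)))"
proof -
  have "(\<Sum>j\<le>Suc n. of_nat (Suc n choose j) * g j) =
        (g 0 + (\<Sum>j\<le>n. of_nat (n choose Suc j) * g (Suc j))) +
        (\<Sum>j\<le>n. of_nat (n choose j) * g (Suc j))"
    by (subst sum.atMost_Suc_shift) (simp add: algebra_simps sum.distrib)
  also have "g 0 + (\<Sum>j\<le>n. of_nat (n choose Suc j) * g (Suc j)) =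
             (\<Sum>j\<le>Suc n. of_nat (n choose j) * g j)"
    by (subst sum.atMost_Suc_shift) simp
  also have "\<dots> = (\<Sum>j\<le>n. of_nat (n choose j) * g j)"
    by (simp add: binomial_eq_0)
  finally show ?thesis
    by (simp add: algebra_simps sum.distrib)
qed

text \<open>If \<open>E\<close> shifts the argument by 1, \<open>even_fib_rec\<close> says that
  \<open>1 + E^2 = 3 E\<close> on \<open>even_fib\<close>; this is the binomial expansion of the
  \<open>n\<close>-th power. The induction keeps \<open>c\<close> arbitrary because its step needs
  both \<open>c\<close> and \<open>c + 2\<close>.\<close>

lemma sum_choose_even_fib:
  "(\<Sum>j\<le>n. int (n choose j) * even_fib (2 * int j + c)) = 3 ^ n * even_fib (int n + c)"
proof (induction n arbitrary: c)
  case 0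
  then show ?case by simp
next
  case (Suc n)
  have "(\<Sum>j\<le>Suc n. int (Suc n choose j) * even_fib (2 * int j + c)) =
        (\<Sum>j\<le>n. int (n choose j) * (even_fib (2 * int j + c) + even_fib (2 * int j + (c + 2))))"
    by (subst sum_choose_Suc_mult) (simp add: algebra_simps)
  also have "\<dots> = 3 ^ n * (even_fib (int n + c + 2) + even_fib (int n + c))"
    by (simp add: distrib_left sum.distrib Suc.IH add.assoc)
  also have "\<dots> = 3 ^ Suc n * even_fib (int (Suc n) + c)"
    unfolding even_fib_rec by (simp add: algebra_simps)
  finally show ?case .
qed

text \<open>With \<open>q = p ^ f\<close>, \<open>j * C(q, j) = q * C(q - 1, j - 1)\<close>. If
  \<open>p\<close> did not divide \<open>C(q, j)\<close>, all of \<open>q\<close> would have to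
  divide \<open>j\<close>, which is too small.\<close>

lemma prime_dvd_choose_prime_power:
  fixes p :: nat
  assumes "prime p" "0 < j" "j < p ^ f"
  shows "p dvd (p ^ f choose j)"
proof (rule ccontr)
  assume "\<not> p dvd (p ^ f choose j)"
  then have "coprime (p ^ f) (p ^ f choose j)"
    using assms(1) by (simp add: prime_imp_coprime)
  moreover have "p ^ f dvd j * (p ^ f choose j)"
    using times_binomial_minus1_eq [OF assms(2), of "p ^ f"] by simp
  ultimately have "p ^ f dvd j"
    by (simp add: coprime_dvd_mult_left_iff)
  with assms show False
    using nat_dvd_not_less by blast
qed

lemma cong_pow_prime_power:
  fixes a p :: nat
  assumes "prime p"
  shows "[a ^ (p ^ f) = a] (mod p)"
proof (induction f)
  case (Suc f)
  have fermat: "[b ^ p = b] (mod p)" for b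
  proof (cases "p dvd b")
    case True
    then show ?thesis
      using assms prime_gt_0_nat [OF assms]
      by (simp add: cong_def dvd_imp_mod_0 dvd_trans [OF _ dvd_power])
  next
    case False
    then have "[b ^ (p - 1) = 1] (mod p)"
      using assms fermat_theorem by simp
    then have "[b ^ (p - 1) * b = 1 * b] (mod p)"
      by (rule cong_scalar_right)
    then show ?thesis
      using prime_gt_0_nat [OF assms] by (simp only: power_minus_mult mult_1)
  qed
  have "[(a ^ p ^ f) ^ p = a ^ p ^ f] (mod p)"
    by (rule fermat)
  also have "[a ^ p ^ f = a] (mod p)"
    by (rule Suc)
  finally show ?case
    by (simp add: power_mult [symmetric] mult.commute)
qed simp

text \<open>In \<open>sum_choose_even_fib\<close> with \<open>n = q\<close> only the terms
  \<open>j = 0\<close> and \<open>j = q\<close> survive modulo \<open>p\<close>, and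
  \<open>3 ^ q\<close> reduces to 3 by Fermat.\<close>

lemma even_fib_cong:
  assumes "prime p" "q = p ^ f"
  shows "[even_fib c + even_fib (2 * int q + c) = 3 * even_fib (int q + c)] (mod int p)"
proof -
  have q: "q > 0"
    using assms prime_gt_0_nat by simp
  let ?t = "\<lambda>j. int (q choose j) * even_fib (2 * int j + c)"
  have split: "{..q} = insert 0 (insert q {0<..<q})"
    using q by auto
  have "[(\<Sum>j\<in>{0<..<q}. ?t j) = (\<Sum>j\<in>{0<..<q}. 0)] (mod int p)"
    using prime_dvd_choose_prime_power [OF assms(1)] assms(2)
    by (intro cong_sum) (auto simp: cong_0_iff)
  then have "[even_fib c + even_fib (2 * int q + c) + (\<Sum>j\<in>{0<..<q}. ?t j) =
     even_fib c + even_fib (2 * int q + c) + 0] (mod int p)"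
    by (intro cong_add cong_refl) simp
  moreover have "even_fib c + even_fib (2 * int q + c) + (\<Sum>j\<in>{0<..<q}. ?t j) = (\<Sum>j\<le>q. ?t j)"
    unfolding split using q by (simp add: add.assoc)
  ultimately have "[even_fib c + even_fib (2 * int q + c) = 3 ^ q * even_fib (int q + c)] (mod int p)"
    by (simp add: sum_choose_even_fib cong_sym_eq)
  also have "[3 ^ q * even_fib (int q + c) = 3 * even_fib (int q + c)] (mod int p)"
    using cong_pow_prime_power [OF assms(1), of 3 f] assms(2)
    by (intro cong_mult cong_refl) (simp flip: cong_int_iff)
  finally show ?thesis .
qed

text \<open>In Vandermonde's expansion every term with \<open>0 < j <= k < q\<close> contains a
  factor \<open>C(q, j)\<close> divisible by \<open>p\<close>.\<close>

lemma choose_prime_power_add_cong: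
  fixes p :: nat
  assumes "prime p" "q = p ^ f" "k < q"
  shows "[(q + a) choose k = a choose k] (mod p)"
proof -
  have split: "{..k} = insert 0 {0<..k}"
    by auto
  have "[(\<Sum>j\<in>{0<..k}. (q choose j) * (a choose (k - j))) = (\<Sum>j\<in>{0<..k}. 0)] (mod p)"
    using prime_dvd_choose_prime_power [OF assms(1)] assms(2,3)
    by (intro cong_sum) (auto simp: cong_0_iff)
  then have "[(a choose k) + (\<Sum>j\<in>{0<..k}. (q choose j) * (a choose (k - j))) = (a choose k) + 0] (mod p)"
    by (intro cong_add cong_refl) simp
  then show ?thesis
    unfolding vandermonde [symmetric] split by simp
qed

text \<open>Removing \<open>q\<close> from the upper index \<open>3 * k\<close> leaves
  \<open>3 * k - q < k\<close>, so the reduced binomial coefficient is zero.\<close>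

lemma dvd_choose_3:
  fixes p :: nat
  assumes "prime p" "q = p ^ f" "q \<le> 3 * k" "2 * k < q"
  shows "p dvd ((3 * k) choose k)"
  using choose_prime_power_add_cong [OF assms(1,2), of k "3 * k - q"] assms(3,4)
  by (simp add: cong_0_iff binomial_eq_0)


section \<open>Arithmetic of congruences in the localization at \<open>p\<close>\<close>

lemma localized_ints_of_int: "of_int a \<in> localized_ints p"
  unfolding localized_ints_def by (force intro: exI [of _ a] exI [of _ 1])

lemma localized_ints_of_nat: "of_nat a \<in> localized_ints p"
  using localized_ints_of_int [of "int a"] by simp

lemma localized_ints_mult:
  assumes "x \<in> localized_ints p" "y \<in> localized_ints p"
  shows "x * y \<in> localized_ints p"
proof -
  from assms obtain a b c d where
    "x = of_int a / of_int b" "b \<noteq> 0" "coprime b (int p)"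
    "y = of_int c / of_int d" "d \<noteq> 0" "coprime d (int p)"
    unfolding localized_ints_def by blast
  then have "x * y = of_int (a * c) / of_int (b * d)" "b * d \<noteq> 0" "coprime (b * d) (int p)"
    by simp_all
  then show ?thesis
    unfolding localized_ints_def by blast
qed

lemma localized_ints_add:
  assumes "x \<in> localized_ints p" "y \<in> localized_ints p"
  shows "x + y \<in> localized_ints p"
proof -
  from assms obtain a b c d where
    "x = of_int a / of_int b" "b \<noteq> 0" "coprime b (int p)"
    "y = of_int c / of_int d" "d \<noteq> 0" "coprime d (int p)"
    unfolding localized_ints_def by blast
  then have "x + y = of_int (a * d + c * b) / of_int (b * d)" "b * d \<noteq> 0" "coprime (b * d) (int p)"
    by (simp_all add: field_simps)
  then show ?thesis
    unfolding localized_ints_def by blast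
qed

lemma localized_ints_uminus: "x \<in> localized_ints p \<Longrightarrow> - x \<in> localized_ints p"
  using localized_ints_mult [OF localized_ints_of_int [of "-1"]] by simp

lemma localized_ints_divide_of_nat:
  assumes "x \<in> localized_ints p" "d > 0" "coprime d p"
  shows "x / of_nat d \<in> localized_ints p"
proof -
  have "1 / of_nat d \<in> localized_ints p"
    unfolding localized_ints_def using assms(2,3)
    by (force intro: exI [of _ 1] exI [of _ "int d"] simp: coprime_int_iff)
  then show ?thesis
    using localized_ints_mult [OF assms(1)] by fastforce
qed

lemma cong_localized_refl: "x \<in> localized_ints p \<Longrightarrow> cong_localized x x p"
  using localized_ints_of_int [of 0] by (auto simp: cong_localized_def)

lemma cong_localized_trans:
  "cong_localized x y p \<Longrightarrow> cong_localized y z p \<Longrightarrow> cong_localized x z p"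
  unfolding cong_localized_def
  by (metis diff_add_cancel add_diff_eq distrib_left localized_ints_add)

lemma cong_localized_add:
  assumes "cong_localized x y p" "cong_localized u v p"
  shows "cong_localized (x + u) (y + v) p"
proof -
  from assms obtain z w where
    "z \<in> localized_ints p" "x - y = of_nat p * z" "w \<in> localized_ints p" "u - v = of_nat p * w"
    unfolding cong_localized_def by blast
  then have "(x + u) - (y + v) = of_nat p * (z + w)" "z + w \<in> localized_ints p"
    by (simp_all add: algebra_simps localized_ints_add)
  with assms show ?thesis
    unfolding cong_localized_def using localized_ints_add by blast
qed

lemma cong_localized_mult:
  assumes "cong_localized x y p" "cong_localized u v p"
  shows "cong_localized (x * u) (y * v) p"
proof -
  from assms obtain z w where
    z: "z \<in> localized_ints p" "x - y = of_nat p * z" and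
    w: "w \<in> localized_ints p" "u - v = of_nat p * w"
    unfolding cong_localized_def by blast
  have "x * u - y * v = (x - y) * u + y * (u - v)"
    by (simp add: algebra_simps)
  also have "\<dots> = of_nat p * (z * u + y * w)"
    unfolding z(2) w(2) by (simp add: algebra_simps)
  finally show ?thesis
    using assms z(1) w(1) localized_ints_add localized_ints_mult
    unfolding cong_localized_def by blast
qed

lemma cong_localized_sym: "cong_localized x y p \<Longrightarrow> cong_localized y x p"
  unfolding cong_localized_def
  by (metis localized_ints_uminus minus_diff_eq mult_minus_right)

lemma cong_localized_diff:
  assumes "cong_localized x y p" "cong_localized u v p"
  shows "cong_localized (x - u) (y - v) p"
  using cong_localized_add [OF assms(1) cong_localized_mult
      [OF cong_localized_refl [OF localized_ints_of_int [of "-1"]] assms(2)]]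
  by simp

lemma cong_localized_sum:
  assumes "\<And>k. k \<in> A \<Longrightarrow> cong_localized (g k) (h k) p"
  shows "cong_localized (sum g A) (sum h A) p"
  using assms
  by (induction A rule: infinite_finite_induct)
    (use localized_ints_of_int [of 0] in \<open>auto intro: cong_localized_add cong_localized_refl\<close>)

lemma cong_localized_prod:
  assumes "\<And>k. k \<in> A \<Longrightarrow> cong_localized (g k) (h k) p"
  shows "cong_localized (prod g A) (prod h A) p"
  using assms
  by (induction A rule: infinite_finite_induct)
    (use localized_ints_of_int [of 1] in \<open>auto intro: cong_localized_mult cong_localized_refl\<close>)

lemma cong_localized_of_int:
  assumes "[a = b] (mod int p)"
  shows "cong_localized (of_int a) (of_int b) p"
proof -
  from assms obtain c where "a - b = int p * c"
    by (metis cong_iff_dvd_diff dvd_def)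
  then have "of_int a - of_int b = of_nat p * (of_int c :: rat)"
    by (metis of_int_diff of_int_mult of_int_of_nat_eq)
  then show ?thesis
    unfolding cong_localized_def using localized_ints_of_int by blast
qed

lemma cong_localized_mult_modulus_0:
  "z \<in> localized_ints p \<Longrightarrow> cong_localized (of_nat p * z) 0 p"
  unfolding cong_localized_def
  using localized_ints_mult [OF localized_ints_of_nat] localized_ints_of_int [of 0]
  by (auto simp del: mult_eq_0_iff)

text \<open>Write \<open>d = p ^ v * u\<close> with \<open>p\<close> not dividing \<open>u\<close>.
  As \<open>q\<close> does not divide \<open>d\<close>, \<open>v < f\<close>, so
  \<open>q / d\<close> keeps at least one factor \<open>p\<close>.\<close>

lemma cong_localized_prime_power_divide:
  assumes "prime p" "q = p ^ f" "\<not> q dvd d" "c \<in> localized_ints p"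
  shows "cong_localized (c * of_nat q / of_nat d) 0 p"
proof -
  have "d \<noteq> 0"
    using assms(3) by (cases "d = 0") simp_all
  then obtain v u where d: "d = p ^ v * u" "\<not> p dvd u"
    using prime_power_canonical [OF assms(1), of d] by (auto simp: mult.commute)
  have "v < f"
    using assms(2,3) d(1) by (metis dvd_triv_left dvd_trans le_imp_power_dvd not_less)
  then have "q = p ^ v * (p * p ^ (f - v - 1))"
    using assms(2) by (simp flip: power_Suc power_add)
  then have "of_nat q / of_nat d = of_nat p * (of_nat (p ^ (f - v - 1)) / of_nat u :: rat)"
    using d prime_gt_0_nat [OF assms(1)] by simp
  then have eq: "c * of_nat q / of_nat d = of_nat p * (c * (of_nat (p ^ (f - v - 1)) / of_nat u))"
    by (metis mult.left_commute times_divide_eq_right)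
  have "u > 0" "coprime u p"
    using d \<open>d \<noteq> 0\<close> prime_imp_coprime [OF assms(1), of u] by (auto simp: coprime_commute intro: Nat.gr0I)
  then have "c * (of_nat (p ^ (f - v - 1)) / of_nat u) \<in> localized_ints p"
    by (intro localized_ints_mult assms(4) localized_ints_divide_of_nat localized_ints_of_nat)
  then show ?thesis
    unfolding eq by (rule cong_localized_mult_modulus_0)
qed

section \<open>Exact comparison of \<open>C(N + k, 2k)\<close> with \<open>C(3k, k)\<close>\<close>

text \<open>Ratio of consecutive terms, with denominators cleared so that it stays in the naturals.
  The truncated \<open>N - k\<close> is harmless: for \<open>k >= N\<close> both sides
  vanish.\<close>

lemma choose_add_double_step:
  "(2 * k + 1) * (2 * k + 2) * ((N + Suc k) choose (2 * Suc k)) =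
     (N + k + 1) * (N - k) * ((N + k) choose (2 * k))"
proof -
  have 1: "(2 * k + 2) * ((N + Suc k) choose (2 * Suc k)) = (N + k + 1) * ((N + k) choose (2 * k + 1))"
    using Suc_times_binomial [of "2 * k + 1" "N + k"] by simp
  have 2: "(2 * k + 1) * ((N + k) choose (2 * k + 1)) = (N - k) * ((N + k) choose (2 * k))"
    using binomial_absorption [of "2 * k" "N + k"] binomial_absorb_comp [of "N + k" "2 * k"]
    by simp
  show ?thesis
    unfolding mult.assoc 1 mult.left_commute [of "2 * k + 1"] 2 ..
qed

text \<open>The same ratio for \<open>C(3k, k)\<close>, obtained by descending through
  \<open>C(3k + 2, k)\<close> and \<open>C(3k + 1, k)\<close> with absorption identities.\<close>

lemma choose_triple_step:
  "(2 * k + 1) * (2 * k + 2) * ((3 * Suc k) choose Suc k) =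
     3 * (3 * k + 1) * (3 * k + 2) * ((3 * k) choose k)"
proof -
  have "Suc k * ((3 * Suc k) choose Suc k) = Suc k * (3 * ((3 * k + 2) choose k))"
    using Suc_times_binomial [of k "3 * k + 2"]
    by (simp add: algebra_simps numeral_3_eq_3 del: binomial_Suc_Suc)
  then have 1: "(3 * Suc k) choose Suc k = 3 * ((3 * k + 2) choose k)"
    by (simp only: mult_cancel1 nat.distinct simp_thms)
  have 2: "(2 * k + 2) * ((3 * k + 2) choose k) = (3 * k + 2) * ((3 * k + 1) choose k)"
    using binomial_absorb_comp [of "3 * k + 2" k] by simp
  have 3: "(2 * k + 1) * ((3 * k + 1) choose k) = (3 * k + 1) * ((3 * k) choose k)"
    using binomial_absorb_comp [of "3 * k + 1" k] by simp
  have "(2 * k + 1) * (2 * k + 2) * ((3 * Suc k) choose Suc k) =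
      3 * ((2 * k + 1) * ((2 * k + 2) * ((3 * k + 2) choose k)))"
    unfolding 1 by (simp only: ac_simps)
  also have "\<dots> = 3 * ((3 * k + 2) * ((2 * k + 1) * ((3 * k + 1) choose k)))"
    unfolding 2 by (simp only: ac_simps)
  also have "\<dots> = 3 * (3 * k + 1) * (3 * k + 2) * ((3 * k) choose k)"
    unfolding 3 by (simp only: ac_simps)
  finally show ?thesis .
qed

lemma choose_add_double_eq_choose_triple:
  fixes a b r k N :: nat
  assumes "(a, b) \<in> {(1, 2), (2, 1)}" "3 * N + b = r" "k \<le> N"
  shows "(-27) ^ k * of_nat ((N + k) choose (2 * k)) =
         (of_nat ((3 * k) choose k) :: rat) *
         (\<Prod>i<k. (1 + of_nat r / of_nat (3 * i + a)) * (1 - of_nat r / of_nat (3 * i + b)))"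
  using assms(3)
proof (induction k)
  case 0
  then show ?case by simp
next
  case (Suc k)
  define A B P where "A = (of_nat ((N + k) choose (2 * k)) :: rat)"
    and "B = (of_nat ((3 * k) choose k) :: rat)"
    and "P = (\<Prod>i<k. (1 + of_nat r / of_nat (3 * i + a)) * (1 - of_nat r / of_nat (3 * i + b)) :: rat)"
  define A' B' where "A' = (of_nat ((N + Suc k) choose (2 * Suc k)) :: rat)"
    and "B' = (of_nat ((3 * Suc k) choose Suc k) :: rat)"
  define D where "D = (of_nat ((2 * k + 1) * (2 * k + 2)) :: rat)"
  define m n where "m = (of_nat k :: rat)" and "n = (of_nat N :: rat)"
  have "D \<noteq> 0"
    unfolding D_def of_nat_eq_0_iff by simp
  have IH: "(-27) ^ k * A = B * P"
    unfolding A_def B_def P_def using Suc by simp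
  have A: "D * A' = (n + m + 1) * (n - m) * A"
    unfolding D_def A_def A'_def m_def n_def
    using arg_cong [OF choose_add_double_step [of k N], of "of_nat :: nat \<Rightarrow> rat"] Suc.prems
    by (simp only: of_nat_mult of_nat_add of_nat_diff [OF Suc_leD] of_nat_1)
  have B: "D * B' = 3 * (3 * m + 1) * (3 * m + 2) * B"
    unfolding D_def B_def B'_def m_def
    using arg_cong [OF choose_triple_step [of k], of "of_nat :: nat \<Rightarrow> rat"]
    by (simp add: algebra_simps del: binomial_Suc_Suc)
  \<comment> \<open>The quotient of the two step ratios. Since \<open>a + b = 3\<close> and
    \<open>r = 3 * N + b\<close>, the numerators are \<open>3 * (n + m + 1)\<close> and
    \<open>-3 * (n - m)\<close>; the remaining factor 3 in -27 = 3 * (-9) comes from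
    \<open>choose_triple_step\<close>.\<close>
  have "(3 * m + 1) * (3 * m + 2) *
      ((1 + of_nat r / of_nat (3 * k + a)) * (1 - of_nat r / of_nat (3 * k + b))) =
      (3 * m + of_nat a + of_nat r) * (3 * m + of_nat b - of_nat r)"
  proof -
    have "3 * m + 1 \<noteq> 0" "3 * m + 2 \<noteq> 0"
      unfolding m_def by (metis of_nat_0_le_iff add_nonneg_pos less_irrefl mult_nonneg_nonneg
          zero_le_numeral zero_less_one zero_less_numeral)+
    then show ?thesis
      using assms(1) by (auto simp: m_def divide_simps)
  qed
  also have "\<dots> = - 9 * (n + m + 1) * (n - m)"
    using assms(1,2) by (auto simp: n_def algebra_simps)
  finally have F: "(3 * m + 1) * (3 * m + 2) *
      ((1 + of_nat r / of_nat (3 * k + a)) * (1 - of_nat r / of_nat (3 * k + b))) =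
      - 9 * (n + m + 1) * (n - m)" .
  have "D * ((-27) ^ Suc k * A') = (-27) ^ Suc k * (D * A')"
    by (simp only: ac_simps)
  also have "\<dots> = (-27) * (n + m + 1) * (n - m) * ((-27) ^ k * A)"
    unfolding A power_Suc by (simp only: ac_simps)
  also have "\<dots> = 3 * (- 9 * (n + m + 1) * (n - m)) * B * P"
    unfolding IH by simp
  also have "\<dots> = (3 * (3 * m + 1) * (3 * m + 2) * B) *
      (P * ((1 + of_nat r / of_nat (3 * k + a)) * (1 - of_nat r / of_nat (3 * k + b))))"
    unfolding F [symmetric] by (simp only: ac_simps)
  also have "\<dots> = D * (B' *
      (P * ((1 + of_nat r / of_nat (3 * k + a)) * (1 - of_nat r / of_nat (3 * k + b)))))"
    unfolding B [symmetric] by (simp only: ac_simps)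
  finally show ?case
    using \<open>D \<noteq> 0\<close> by (simp only: mult_cancel_left A'_def B'_def P_def prod.lessThan_Suc simp_thms)
qed


section \<open>Reduction of the comparison modulo \<open>p\<close>\<close>

text \<open>Both denominators lie strictly between 0 and \<open>2 * q\<close>, so \<open>q\<close>
  can divide one of them only by being equal to it.\<close>

lemma cong_localized_ratio_factor:
  fixes a b t N i p q :: nat
  assumes "prime p" "q = p ^ f" "\<not> 3 dvd q"
    and "(a, b) \<in> {(1, 2), (2, 1)}" "t \<in> {1, 2}" "3 * N + b = t * q" "i < N"
  shows "cong_localized
           ((1 + of_nat (t * q) / of_nat (3 * i + a)) * (1 - of_nat (t * q) / of_nat (3 * i + b)))
           (if 3 * i + a = q then 1 + of_nat t else 1) p"
proof -
  have less: "d < 2 * q \<Longrightarrow> d \<noteq> q \<Longrightarrow> 0 < d \<Longrightarrow> \<not> q dvd d" for d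
    by auto
  have vanish: "cong_localized (of_nat (t * q) / of_nat d) 0 p" if "\<not> q dvd d" for d
    using cong_localized_prime_power_divide [OF assms(1,2) that localized_ints_of_nat [of t]]
    by simp
  \<comment> \<open>For \<open>t = 1\<close>, \<open>i < N\<close> gives
    \<open>3 * i + b < q\<close>. For \<open>t = 2\<close>, subtracting from
    \<open>3 * N + b = 2 * q\<close> would make \<open>q\<close> a multiple of 3.\<close>
  have "3 * i + b \<noteq> q"
  proof
    assume "3 * i + b = q"
    with assms(5,6) have "t = 2"
      using assms(7) by auto
    with assms(6) \<open>3 * i + b = q\<close> have "q = 3 * (N - i)"
      by simp
    with assms(3) show False
      by simp
  qed
  moreover have "3 * i + b < 2 * q" "3 * i + a < 2 * q" "0 < 3 * i + a" "0 < 3 * i + b"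
    using assms(4-7) by auto
  ultimately have b: "cong_localized (1 - of_nat (t * q) / of_nat (3 * i + b)) (1 - 0) p"
    using localized_ints_of_int [of 1]
    by (intro cong_localized_diff cong_localized_refl vanish less) simp_all
  have a: "cong_localized (1 + of_nat (t * q) / of_nat (3 * i + a))
             (if 3 * i + a = q then 1 + of_nat t else 1) p"
  proof (cases "3 * i + a = q")
    case True
    have "1 + of_nat (t * q) / of_nat (3 * i + a) = (of_nat (1 + t) :: rat)"
      unfolding True using \<open>0 < 3 * i + a\<close> True by simp
    then show ?thesis
      using True cong_localized_refl [OF localized_ints_of_nat [of "1 + t"]] by simp
  next
    case False
    then have "cong_localized (1 + of_nat (t * q) / of_nat (3 * i + a)) (1 + 0) p"
      using localized_ints_of_int [of 1] \<open>3 * i + a < 2 * q\<close> \<open>0 < 3 * i + a\<close>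
      by (intro cong_localized_add cong_localized_refl vanish less) simp_all
    then show ?thesis
      using False by simp
  qed
  show ?thesis
    using cong_localized_mult [OF a b] by simp
qed

lemma cong_localized_choose_add_double:
  fixes a b t N k p q :: nat
  assumes "prime p" "p \<noteq> 3" "q = p ^ f"
    and "(a, b) \<in> {(1, 2), (2, 1)}" "t \<in> {1, 2}" "3 * N + b = t * q" "k \<le> N"
  shows "cong_localized
           (of_nat ((N + k) choose (2 * k)) * (-9) ^ k)
           ((if q < 3 * k then 1 + of_nat t else 1) * (of_nat ((3 * k) choose k) / 3 ^ k)) p"
proof -
  have "coprime 3 p"
    using assms(1,2) primes_coprime [of 3 p] by simp
  then have "coprime 3 q"
    using assms(3) by simp
  then have "\<not> 3 dvd q"
    using coprime_common_divisor_nat [of 3 q 3] by auto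
  define Q where "Q = (\<Prod>i<k. (1 + of_nat (t * q) / of_nat (3 * i + a)) *
      (1 - of_nat (t * q) / of_nat (3 * i + b)) :: rat)"
  have "cong_localized Q (\<Prod>i<k. if 3 * i + a = q then 1 + of_nat t else 1) p"
    unfolding Q_def using assms \<open>\<not> 3 dvd q\<close>
    by (intro cong_localized_prod cong_localized_ratio_factor [where N = N and f = f]) auto
  \<comment> \<open>At most the index \<open>i = q div 3\<close> contributes, and it lies below
    \<open>k\<close> exactly when \<open>q < 3 * k\<close>. If \<open>a\<close> is not the residue
    of \<open>q\<close>, then \<open>t = 1\<close> and \<open>3 * k <= 3 * N < q\<close>.\<close>
  also have "(\<Prod>i<k. if 3 * i + a = q then 1 + of_nat t else 1) =
             (if q < 3 * k then 1 + of_nat t else 1 :: rat)"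
  proof (cases "q mod 3 = a")
    case True
    then have "3 * i + a = q \<longleftrightarrow> i = q div 3" for i
      using assms(4) True mult_div_mod_eq [of 3 q] by auto
    moreover have "q div 3 < k \<longleftrightarrow> q < 3 * k"
      using \<open>\<not> 3 dvd q\<close> by auto
    ultimately show ?thesis
      by (simp add: prod.delta)
  next
    case False
    then have "3 * i + a \<noteq> q" for i
      using assms(4) False by (auto; presburger)
    moreover have "\<not> q < 3 * k"
    proof -
      have "t = 1"
        using False assms(4-6) \<open>\<not> 3 dvd q\<close> by (auto; presburger)
      then show ?thesis
        using assms(6,7) by simp
    qed
    ultimately show ?thesis
      by simp
  qed
  finally have Q: "cong_localized Q (if q < 3 * k then 1 + of_nat t else 1) p" .
  have "(-27) ^ k = (3 ^ k * (-9) ^ k :: rat)"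
    by (simp flip: power_mult_distrib)
  then have "of_nat ((N + k) choose (2 * k)) * (-9) ^ k =
      Q * (of_nat ((3 * k) choose k) / 3 ^ k)"
    using choose_add_double_eq_choose_triple [OF assms(4,6,7)]
    unfolding Q_def [symmetric] by (simp add: field_simps)
  moreover have "of_nat ((3 * k) choose k) / 3 ^ k \<in> localized_ints p"
    using localized_ints_divide_of_nat [OF localized_ints_of_nat, of "3 ^ k" p] \<open>coprime 3 p\<close>
    by simp
  ultimately show ?thesis
    using cong_localized_mult [OF Q cong_localized_refl] by metis
qed

lemma cong_localized_sum_choose_triple:
  fixes a b t N p q :: nat
  assumes "prime p" "p \<noteq> 3" "q = p ^ f"
    and "(a, b) \<in> {(1, 2), (2, 1)}" "t \<in> {1, 2}" "3 * N + b = t * q"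
  shows "cong_localized
           (\<Sum>k\<le>N. (if q < 3 * k then 1 + of_nat t else 1) * (of_nat ((3 * k) choose k) / 3 ^ k))
           (of_int ((-1) ^ N * even_fib (2 * int N + 1))) p"
proof -
  have "cong_localized
           (\<Sum>k\<le>N. of_nat ((N + k) choose (2 * k)) * (-9) ^ k)
           (\<Sum>k\<le>N. (if q < 3 * k then 1 + of_nat t else 1) * (of_nat ((3 * k) choose k) / 3 ^ k)) p"
    using assms by (intro cong_localized_sum cong_localized_choose_add_double) simp_all
  moreover have "even_fib (2 * int N + 1) = int (fib (4 * N + 2))"
    using even_fib_of_nat [of "2 * N + 1"] by (simp add: add.commute)
  then have "(\<Sum>k\<le>N. of_nat ((N + k) choose (2 * k)) * (-9) ^ k :: rat) =
      of_int ((-1) ^ N * even_fib (2 * int N + 1))"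
    by (simp only: sum_choose_neg_9_pow(1) [symmetric]) simp
  ultimately show ?thesis
    using cong_localized_sym by simp
qed

section \<open>The Legendre symbol modulo 3\<close>

lemma mod3_cases: "a mod 3 = 0 \<or> a mod 3 = 1 \<or> a mod 3 = (2 :: int)"
  by presburger

lemma Legendre_3: "Legendre a 3 = (if a mod 3 = 0 then 0 else if a mod 3 = 1 then 1 else -1)"
proof -
  have "QuadRes 3 a \<longleftrightarrow> a mod 3 \<noteq> 2"
  proof -
    consider "a mod 3 = 0" | "a mod 3 = 1" | "a mod 3 = 2"
      using mod3_cases by blast
    then show ?thesis
    proof cases
      case 1
      then show ?thesis
        unfolding QuadRes_def cong_def by (auto intro: exI [of _ 0])
    next
      case 2
      then show ?thesis
        unfolding QuadRes_def cong_def by (auto intro: exI [of _ 1])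
    next
      case 3
      have "y ^ 2 mod 3 \<noteq> 2" for y :: int
      proof -
        have "y mod 3 = 0 \<or> y mod 3 = 1 \<or> y mod 3 = 2"
          by (rule mod3_cases)
        moreover have "y ^ 2 mod 3 = (y mod 3) ^ 2 mod 3"
          by (simp add: power_mod)
        ultimately show ?thesis
          by auto
      qed
      with 3 show ?thesis
        unfolding QuadRes_def cong_def by simp
    qed
  qed
  then show ?thesis
    unfolding Legendre_def cong_def by auto
qed

section \<open>Assembly of the two congruences\<close>

theorem mainTheorem5:
  fixes p q f :: nat and \<epsilon> :: int
  assumes "prime p" and "p > 3"
    and "f \<ge> 1" and "q = p ^ f"
    and "\<epsilon> = Legendre (int q) 3"
  shows "cong_localized
           (\<Sum>k | of_nat k < (of_nat q / 3 :: rat). of_nat ((3 * k) choose k) / 3 ^ k)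
           (of_int \<epsilon> * of_nat (fib (nat (2 * (2 * int q + \<epsilon>) div 3)))) p
       \<and> cong_localized
           (\<Sum>k | (of_nat q / 2 :: rat) < of_nat k \<and> of_nat k < (2 * of_nat q / 3 :: rat).
              of_nat ((3 * k) choose k) / 3 ^ k)
           (of_int \<epsilon> * of_nat (fib (nat (2 * (int q - \<epsilon>) div 3)))) p"
proof -
  define T where "T k = (of_nat ((3 * k) choose k) / 3 ^ k :: rat)" for k
  define n N m where "n = q div 3" and "N = 2 * q div 3" and "m = 2 * int n + 1"
  have "coprime 3 p"
    using assms(1,2) primes_coprime [of 3 p] by simp
  then have "coprime 3 q"
    using assms(4) by simp
  then have "\<not> 3 dvd q"
    using coprime_common_divisor_nat [of 3 q 3] by auto
  then have q3: "q mod 3 = 1 \<or> q mod 3 = 2"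
    by presburger
  have "odd p"
    using assms(1,2) prime_odd_nat by simp
  then have "odd q"
    using assms(4) by simp
  have \<epsilon>: "\<epsilon> = (if q mod 3 = 1 then 1 else -1)"
    using q3 zmod_int [of q 3] unfolding assms(5) Legendre_3 by auto
  have cases: "q = 3 * n + 1 \<and> N = 2 * n \<and> \<epsilon> = 1 \<or> q = 3 * n + 2 \<and> N = 2 * n + 1 \<and> \<epsilon> = -1"
  proof (cases "q mod 3 = 1")
    case True
    then have "q = 3 * n + 1"
      using mult_div_mod_eq [of 3 q] by (simp add: n_def)
    moreover from this have "N = 2 * n"
      unfolding N_def by simp
    ultimately show ?thesis
      using True \<epsilon> by simp
  next
    case False
    then have "q = 3 * n + 2"
      using q3 mult_div_mod_eq [of 3 q] by (simp add: n_def)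
    moreover from this have "N = 2 * n + 1"
      unfolding N_def by simp
    ultimately show ?thesis
      using False \<epsilon> by simp
  qed
  \<comment> \<open>As \<open>q\<close> is odd, \<open>n\<close> is even when
    \<open>q = 3 * n + 1\<close> and odd when \<open>q = 3 * n + 2\<close>.\<close>
  then have pow: "(-1) ^ n = \<epsilon>" "(-1) ^ N = \<epsilon>"
    using \<open>odd q\<close> by auto
  have residues: "(3 - q mod 3, q mod 3) \<in> {(1, 2), (2, 1)}" "(q mod 3, 3 - q mod 3) \<in> {(1, 2), (2, 1)}"
    using q3 by auto
  have N_eq: "3 * N + (3 - q mod 3) = 2 * q"
    using cases \<epsilon> q3 by (auto split: if_splits)
  have N: "2 * int N + 1 = 2 * int q - m"
    using cases unfolding m_def by auto
  have fib1: "even_fib m = int (fib (nat (2 * (2 * int q + \<epsilon>) div 3)))"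
  proof -
    have "2 * (2 * int q + \<epsilon>) = int (2 * (2 * n + 1)) * 3"
      using cases by auto
    then have "nat (2 * (2 * int q + \<epsilon>) div 3) = 2 * (2 * n + 1)"
      by (simp only: nonzero_mult_div_cancel_right)
    moreover have "m = int (2 * n + 1)"
      unfolding m_def by simp
    ultimately show ?thesis
      by (simp only: even_fib_of_nat)
  qed
  have fib2: "even_fib (int q - m) = int (fib (nat (2 * (int q - \<epsilon>) div 3)))"
  proof -
    obtain l where l: "int q - m = int l"
      using cases zero_le_imp_eq_int [of "int q - m"] unfolding m_def by auto
    then have "2 * (int q - \<epsilon>) = int (2 * l) * 3"
      using cases unfolding m_def by auto
    then have "nat (2 * (int q - \<epsilon>) div 3) = 2 * l"
      by (simp only: nonzero_mult_div_cancel_right)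
    with l show ?thesis
      by (simp only: even_fib_of_nat)
  qed

  \<comment> \<open>The case \<open>t = 1\<close>: here \<open>3 * k <= q\<close> throughout, so
    every weight is 1.\<close>
  have first: "cong_localized (\<Sum>k\<le>n. T k) (of_int (\<epsilon> * even_fib m)) p"
  proof -
    have "cong_localized (\<Sum>k\<le>n. (if q < 3 * k then 1 + of_nat 1 else 1) * T k)
        (of_int ((-1) ^ n * even_fib (2 * int n + 1))) p"
      unfolding T_def
      by (rule cong_localized_sum_choose_triple [where a = "3 - q mod 3" and b = "q mod 3" and f = f])
        (use assms residues in \<open>simp_all add: n_def\<close>)
    moreover have "(\<Sum>k\<le>n. (if q < 3 * k then 1 + of_nat 1 else 1) * T k) = (\<Sum>k\<le>n. T k)"
      by (intro sum.cong) (auto simp: n_def)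
    ultimately show ?thesis
      by (simp add: pow m_def)
  qed

  \<comment> \<open>The case \<open>t = 2\<close>, with the roles of \<open>a\<close> and
    \<open>b\<close> exchanged: the weight becomes 3 exactly beyond \<open>n\<close>.\<close>
  have "cong_localized (\<Sum>k\<le>N. (if q < 3 * k then 1 + of_nat 2 else 1) * T k)
      (of_int ((-1) ^ N * even_fib (2 * int N + 1))) p"
    unfolding T_def
    by (rule cong_localized_sum_choose_triple [where a = "q mod 3" and b = "3 - q mod 3" and f = f])
      (use assms residues N_eq in simp_all)
  moreover have "(\<Sum>k\<le>N. (if q < 3 * k then 1 + of_nat 2 else 1) * T k) =
      (\<Sum>k\<le>n. T k) + 3 * (\<Sum>k\<in>{n<..N}. T k)"
  proof -
    have split: "{..N} = {..n} \<union> {n<..N}"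
      by (auto simp: n_def N_def)
    have "(\<Sum>k\<le>n. (if q < 3 * k then 1 + of_nat 2 else 1) * T k) = (\<Sum>k\<le>n. T k)"
      by (intro sum.cong) (auto simp: n_def)
    moreover have "(\<Sum>k\<in>{n<..N}. (if q < 3 * k then 1 + of_nat 2 else 1) * T k) =
        (\<Sum>k\<in>{n<..N}. 3 * T k)"
      by (intro sum.cong) (auto simp: n_def)
    ultimately show ?thesis
      unfolding split by (subst sum.union_disjoint) (auto simp: sum_distrib_left)
  qed
  ultimately have both: "cong_localized ((\<Sum>k\<le>n. T k) + 3 * (\<Sum>k\<in>{n<..N}. T k))
      (of_int (\<epsilon> * even_fib (2 * int q - m))) p"
    by (simp add: pow N)

  define S where "S = {k. q < 2 * k \<and> 3 * k < 2 * q}"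
  \<comment> \<open>The terms of \<open>{n<..N}\<close> outside \<open>S\<close> have
    \<open>q <= 3 * k\<close> and, \<open>q\<close> being odd, \<open>2 * k < q\<close>; there
    \<open>dvd_choose_3\<close> applies.\<close>
  have tail: "cong_localized (\<Sum>k\<in>{n<..N}. T k) (\<Sum>k\<in>S. T k) p"
  proof -
    have termwise: "cong_localized (T k) (if k \<in> S then T k else 0) p" if "k \<in> {n<..N}" for k
    proof (cases "k \<in> S")
      case True
      have "T k \<in> localized_ints p"
        using localized_ints_divide_of_nat [OF localized_ints_of_nat, of "3 ^ k" p] \<open>coprime 3 p\<close>
        by (simp add: T_def)
      then show ?thesis
        using True cong_localized_refl by simp
    next
      case False
      have "3 * k < 2 * q"
        using that cases by auto
      moreover have "q \<noteq> 2 * k"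
        using \<open>odd q\<close> by auto
      ultimately have "2 * k < q"
        using False unfolding S_def by simp
      moreover have "q \<le> 3 * k"
        using that unfolding n_def by auto
      ultimately obtain c where c: "(3 * k) choose k = p * c"
        using dvd_choose_3 [OF assms(1,4)] by (auto elim!: dvdE)
      have "of_nat c / of_nat (3 ^ k) \<in> localized_ints p"
        using \<open>coprime 3 p\<close> by (intro localized_ints_divide_of_nat localized_ints_of_nat) simp_all
      then have "cong_localized (of_nat p * (of_nat c / of_nat (3 ^ k))) 0 p"
        by (rule cong_localized_mult_modulus_0)
      then show ?thesis
        using False unfolding T_def c by simp
    qed
    have "S = {n<..N} \<inter> S"
      using cases unfolding S_def by auto
    then have "(\<Sum>k\<in>{n<..N}. if k \<in> S then T k else 0) = (\<Sum>k\<in>S. T k)"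
      by (simp add: sum.inter_restrict [symmetric])
    with cong_localized_sum [OF termwise, of "{n<..N}" "\<lambda>k. k"] show ?thesis
      by simp
  qed
  have "cong_localized (3 * (\<Sum>k\<in>{n<..N}. T k))
      (of_int (\<epsilon> * (even_fib (2 * int q - m) - even_fib m))) p"
    using cong_localized_diff [OF both first] by (simp add: algebra_simps)
  \<comment> \<open>Taking \<open>c = -m\<close> in \<open>even_fib_cong\<close> produces the
    difference, because \<open>even_fib\<close> is odd. The common factor 3 is then cancelled, 3
    being a unit for \<open>p > 3\<close>.\<close>
  moreover have "cong_localized (of_int (\<epsilon> * (even_fib (2 * int q - m) - even_fib m)))
      (of_int (\<epsilon> * (3 * even_fib (int q - m)))) p"
    using even_fib_cong [OF assms(1,4), of "- m"]
    by (intro cong_localized_of_int cong_scalar_left) (simp add: even_fib_minus)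
  moreover have "cong_localized (3 * (\<Sum>k\<in>S. T k)) (3 * (\<Sum>k\<in>{n<..N}. T k)) p"
    using cong_localized_mult [OF cong_localized_refl [OF localized_ints_of_nat [of 3]]
        cong_localized_sym [OF tail]] by simp
  ultimately have "cong_localized (3 * (\<Sum>k\<in>S. T k)) (of_int (\<epsilon> * (3 * even_fib (int q - m)))) p"
    using cong_localized_trans by blast
  moreover have "1 / 3 \<in> localized_ints p"
    using localized_ints_divide_of_nat [OF localized_ints_of_nat, of 3 p 1] \<open>coprime 3 p\<close> by simp
  ultimately have second: "cong_localized (\<Sum>k\<in>S. T k) (of_int (\<epsilon> * even_fib (int q - m))) p"
    using cong_localized_mult [OF cong_localized_refl [of "1 / 3" p],
        of "3 * (\<Sum>k\<in>S. T k)" "of_int (\<epsilon> * (3 * even_fib (int q - m)))"] by simp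

  have "of_nat k < (of_nat q / 3 :: rat) \<longleftrightarrow> k \<le> n" for k
  proof -
    have "of_nat k < (of_nat q / 3 :: rat) \<longleftrightarrow> of_nat (3 * k) < (of_nat q :: rat)"
      by (simp add: field_simps)
    then show ?thesis
      using cases unfolding of_nat_less_iff by auto
  qed
  moreover have "(of_nat q / 2 :: rat) < of_nat k \<and> of_nat k < (2 * of_nat q / 3 :: rat) \<longleftrightarrow> k \<in> S" for k
  proof -
    have "(of_nat q / 2 :: rat) < of_nat k \<longleftrightarrow> of_nat q < (of_nat (2 * k) :: rat)"
      "of_nat k < (2 * of_nat q / 3 :: rat) \<longleftrightarrow> of_nat (3 * k) < (of_nat (2 * q) :: rat)"
      by (simp_all add: field_simps)
    then show ?thesis
      unfolding S_def of_nat_less_iff by simp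
  qed
  ultimately show ?thesis
    using first second unfolding T_def fib1 fib2 by (simp add: atMost_def)
qed

end
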